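(* For any $n\in\mathbb{N}$, there exists a graph $G=(V_1\cup V_2,E)$ on $n$ vertices with VC-dimension at most $2$ such that any 3-spanner for $G$ has $\Omega(n^{3/2})$ edges.
   Context: For a simple graph $G=(V,E)$, a $t$-spanner is a spanning subgraph $G'=(V,E')$, $E'\subseteq E$, with $d_{G'}(x,y)\le t\cdot d_G(x,y)$ for all $x,y\in V$, where $d_G$ is the shortest-path (hop) distance. The VC-dimension of a graph is the VC-dimension of the set system on its vertex set formed by the neighborhoods of its vertices. The $\Omega(\cdot)$ notation is asymptotic as $n\to\infty$, with an absolute constant. *)

theory Defs
  imports Complex_Main "HOL-Library.Extended_Nat"
begin

definition simple_graph :: "'a set \<Rightarrow> 'a set set \<Rightarrow> bool" where
  "simple_graph V E \<longleftrightarrow> finite V \<and> (\<forall>e\<in>E. e \<subseteq> V \<and> card e = 2)"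

definition bipartite_graph :: "'a set \<Rightarrow> 'a set \<Rightarrow> 'a set set \<Rightarrow> bool" where
  "bipartite_graph V1 V2 E \<longleftrightarrow>
     simple_graph (V1 \<union> V2) E \<and> V1 \<inter> V2 = {} \<and>
     (\<forall>e\<in>E. \<exists>u\<in>V1. \<exists>v\<in>V2. e = {u, v})"

definition adjacent :: "'a set set \<Rightarrow> 'a \<Rightarrow> 'a \<Rightarrow> bool" where
  "adjacent E u v \<longleftrightarrow> {u, v} \<in> E"

text \<open>The least length of a walk from \<open>x\<close> to \<open>y\<close>. The relational power is the existence
  of a walk with \<open>k\<close> edges, and the infimum of the empty set is \<open>\<infinity>\<close>, so vertices in
  different components have infinite distance.\<close>

definition graph_dist :: "'a set set \<Rightarrow> 'a \<Rightarrow> 'a \<Rightarrow> enat" where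
  "graph_dist E x y = Inf {enat k | k. (adjacent E ^^ k) x y}"

text \<open>A spanning subgraph keeps the vertex set \<open>V\<close>, so it is given by its edge set \<open>E'\<close>.\<close>

definition spanner :: "nat \<Rightarrow> 'a set \<Rightarrow> 'a set set \<Rightarrow> 'a set set \<Rightarrow> bool" where
  "spanner t V E E' \<longleftrightarrow>
     E' \<subseteq> E \<and> (\<forall>x\<in>V. \<forall>y\<in>V. graph_dist E' x y \<le> enat t * graph_dist E x y)"

definition shatters :: "'a set set \<Rightarrow> 'a set \<Rightarrow> bool" where
  "shatters F A \<longleftrightarrow> (\<forall>B\<subseteq>A. \<exists>S\<in>F. S \<inter> A = B)"

text \<open>The empty set system shatters no set at all and gets dimension \<open>0\<close> here.\<close>

definition vc_dim :: "'a set \<Rightarrow> 'a set set \<Rightarrow> enat" where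
  "vc_dim X F = Sup {enat (card A) | A. A \<subseteq> X \<and> finite A \<and> shatters F A}"

text \<open>Neighborhoods are open: a vertex does not belong to its own neighborhood.\<close>

definition neighborhood :: "'a set \<Rightarrow> 'a set set \<Rightarrow> 'a \<Rightarrow> 'a set" where
  "neighborhood V E v = {u \<in> V. adjacent E v u}"

definition graph_vc_dim :: "'a set \<Rightarrow> 'a set set \<Rightarrow> enat" where
  "graph_vc_dim V E = vc_dim V (neighborhood V E ` V)"

end

theory Submission
  imports Defs "HOL-Library.Z2" "HOL-Algebra.Algebraic_Closure_Type"
begin

text \<open>
  In the point-line incidence graph of the affine plane over a field with \<open>q\<close> elements, two points
  lie on at most one common line, so the graph contains no 4-cycle. In a bipartite graph without
  4-cycles the ends of a deleted edge are at distance at least 5 (distance 3 would close a 4-cycle),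
  hence a 3-spanner keeps every edge. Two vertices of such a graph have at most one common
  neighbor, so no three vertices are shattered. The graph has \<open>2 q\<^sup>2\<close> vertices and \<open>q\<^sup>3\<close> edges, and
  isolated vertices fill it up to \<open>n\<close> vertices. Using the fields with \<open>q = 2\<^sup>k\<close> elements (instead of
  prime fields, which would require a bound on prime gaps), one always finds \<open>2 q\<^sup>2 \<le> n < 8 q\<^sup>2\<close>.
\<close>

section \<open>Graphs without 4-cycles\<close>

text \<open>When every edge has two elements, \<open>u\<close> and \<open>v\<close> automatically
  differ from \<open>x\<close> and \<open>y\<close>, so only the two opposite pairs need a
  distinctness clause.\<close>

definition C4_free :: "'a set set \<Rightarrow> bool" where
  "C4_free E \<longleftrightarrow> (\<forall>u v x y. {u, x} \<in> E \<longrightarrow> {u, y} \<in> E \<longrightarrow> {v, x} \<in> E \<longrightarrow> {v, y} \<in> E \<longrightarrow> u = v \<or> x = y)"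

lemma C4_freeD:
  assumes "C4_free E" "{u, x} \<in> E" "{u, y} \<in> E" "{v, x} \<in> E" "{v, y} \<in> E"
  shows "u = v \<or> x = y"
  using assms unfolding C4_free_def by blast

text \<open>Given three points of \<open>A\<close>, the traces \<open>A\<close> and
  \<open>{a, b}\<close> differ at \<open>c\<close>, so they come from two different vertices, yet
  both are adjacent to \<open>a\<close> and \<open>b\<close>.\<close>

lemma C4_free_shatters_card_le:
  assumes "C4_free E" and sh: "shatters (neighborhood V E ` V) A"
  shows "card A \<le> 2"
proof (rule ccontr)
  assume "\<not> card A \<le> 2"
  then have "3 \<le> card A"
    by simp
  then obtain T where "T \<subseteq> A" "card T = 3"
    using obtain_subset_with_card_n by metis
  then obtain a b c where abc: "a \<in> A" "b \<in> A" "c \<in> A" "a \<noteq> b" "b \<noteq> c" "a \<noteq> c"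
    by (auto simp: card_3_iff)
  have "\<exists>u. neighborhood V E u \<inter> A = B" if "B \<subseteq> A" for B
    using sh that unfolding shatters_def by blast
  from this[of A] this[of "{a, b}"] obtain u v
    where u: "neighborhood V E u \<inter> A = A" and v: "neighborhood V E v \<inter> A = {a, b}"
    using abc by auto
  have "{u, a} \<in> E" "{u, b} \<in> E" "{v, a} \<in> E" "{v, b} \<in> E"
    using u v abc unfolding neighborhood_def adjacent_def by blast+
  with C4_freeD[OF assms(1)] abc have "u = v"
    by blast
  with u v abc show False
    by auto
qed

lemma C4_free_graph_vc_dim_le: "C4_free E \<Longrightarrow> graph_vc_dim V E \<le> 2"
  unfolding graph_vc_dim_def vc_dim_def
  by (rule Sup_least)
    (auto dest: C4_free_shatters_card_le simp: numeral_eq_enat)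

text \<open>A nonempty set in \<open>enat\<close> contains its infimum, so a finite bound yields an
  actual walk; with no walk at all the distance is infinite.\<close>

lemma graph_dist_le_iff: "graph_dist E x y \<le> enat t \<longleftrightarrow> (\<exists>k\<le>t. (adjacent E ^^ k) x y)"
proof
  let ?S = "{enat k | k. (adjacent E ^^ k) x y}"
  assume le: "graph_dist E x y \<le> enat t"
  have "?S \<noteq> {}"
  proof
    assume "?S = {}"
    with le show False
      unfolding graph_dist_def by (simp only: Inf_enat_def) simp
  qed
  then have "(LEAST d. d \<in> ?S) \<in> ?S"
    by (metis (mono_tags, lifting) LeastI ex_in_conv)
  with \<open>?S \<noteq> {}\<close> have "Inf ?S \<in> ?S"
    by (simp only: Inf_enat_def if_False)
  then show "\<exists>k\<le>t. (adjacent E ^^ k) x y"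
    using le unfolding graph_dist_def by auto
next
  assume "\<exists>k\<le>t. (adjacent E ^^ k) x y"
  then obtain k where "k \<le> t" "(adjacent E ^^ k) x y"
    by blast
  then have "graph_dist E x y \<le> enat k"
    unfolding graph_dist_def by (intro Inf_lower) auto
  also have "\<dots> \<le> enat t"
    using \<open>k \<le> t\<close> by simp
  finally show "graph_dist E x y \<le> enat t" .
qed

lemma C4_free_3_spanner_eq:
  assumes bip: "bipartite_graph V1 V2 E" and "C4_free E" and sp: "spanner 3 (V1 \<union> V2) E E'"
  shows "E' = E"
proof
  show sub: "E' \<subseteq> E"
    using sp by (simp add: spanner_def)
  have ends: "\<exists>a\<in>V1. \<exists>b\<in>V2. e = {a, b}" if "e \<in> E" for e
    using bip that by (simp add: bipartite_graph_def)
  have sides: "u \<in> V1 \<and> v \<in> V2 \<and> u \<notin> V2 \<and> v \<notin> V1 \<or> u \<in> V2 \<and> v \<in> V1 \<and> u \<notin> V1 \<and> v \<notin> V2"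
    if uv: "{u, v} \<in> E" for u v
  proof -
    obtain a b where "a \<in> V1" "b \<in> V2" "{u, v} = {a, b}"
      using ends[OF uv] by blast
    moreover have "V1 \<inter> V2 = {}"
      using bip by (simp add: bipartite_graph_def)
    ultimately show ?thesis
      unfolding doubleton_eq_iff by blast
  qed
  show "E \<subseteq> E'"
  proof
    fix e assume "e \<in> E"
    then obtain u v where e: "e = {u, v}" and uv: "u \<in> V1" "v \<in> V2" "{u, v} \<in> E"
      using ends by metis
    have "graph_dist E u v \<le> enat 1"
      using uv unfolding graph_dist_le_iff by (auto simp: adjacent_def eq_OO intro!: exI[of _ 1])
    then have "enat 3 * graph_dist E u v \<le> enat 3 * enat 1"
      by (rule mult_left_mono) simp
    moreover have "graph_dist E' u v \<le> enat 3 * graph_dist E u v"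
      using sp uv unfolding spanner_def by blast
    ultimately have "graph_dist E' u v \<le> enat 3"
      by simp
    then obtain k where "k \<le> 3" and walk: "(adjacent E' ^^ k) u v"
      unfolding graph_dist_le_iff by blast
    then consider "k = 0" | "k = 1" | "k = 2" | "k = 3"
      by linarith
    then show "e \<in> E'"
    proof cases
      case 1
      with walk sides[OF uv(3)] show ?thesis by auto
    next
      case 2
      with walk e show ?thesis by (simp add: adjacent_def eq_OO)
    next
      case 3
      with walk obtain a where "{u, a} \<in> E'" "{a, v} \<in> E'"
        by (auto simp: numeral_eq_Suc adjacent_def eq_OO)
      with sub sides uv show ?thesis by blast
    next
      case 4
      with walk obtain a b where ab: "{u, a} \<in> E'" "{a, b} \<in> E'" "{b, v} \<in> E'"
        by (auto simp: numeral_eq_Suc adjacent_def eq_OO)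
      then have "{u, a} \<in> E" "{b, a} \<in> E" "{b, v} \<in> E"
        using sub by (auto simp: insert_commute)
      \<comment> \<open>The walk u, a, b, v and the edge uv form a closed walk of length 4. It has
        to degenerate, and either way one of its steps in \<open>E'\<close> is the edge
        \<open>e\<close> itself.\<close>
      with C4_freeD[OF \<open>C4_free E\<close>] uv have "u = b \<or> a = v"
        by blast
      with ab e show ?thesis by auto
    qed
  qed
qed

section \<open>Incidence graphs of affine planes\<close>

text \<open>Subtracting the two line equations at each point and then comparing the points cancels
  the intercepts and leaves (m1 - m2)(x1 - x2) = 0.\<close>

lemma affine_incidence_unique:
  fixes x1 x2 m1 m2 :: "'a :: field"
  assumes "y1 = m1 * x1 + b1" "y1 = m2 * x1 + b2" "y2 = m1 * x2 + b1" "y2 = m2 * x2 + b2"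
  shows "x1 = x2 \<and> y1 = y2 \<or> m1 = m2 \<and> b1 = b2"
proof -
  have "(m1 - m2) * (x1 - x2) = (m1 * x1 + b1) - (m2 * x1 + b2) - ((m1 * x2 + b1) - (m2 * x2 + b2))"
    by (simp add: algebra_simps)
  also have "\<dots> = 0"
    using assms by simp
  finally consider "m1 = m2" | "x1 = x2"
    by auto
  then show ?thesis
    using assms by cases simp_all
qed

text \<open>Closure under sums and products puts m x + b back into \<open>F\<close>, which the edge
  count needs; uniqueness of intersections is inherited from the ambient field.\<close>

lemma affine_plane_incidence_graph:
  fixes F :: "'a :: field set"
  assumes fin: "finite F" and q: "card F = q"
    and add: "\<And>x y. x \<in> F \<Longrightarrow> y \<in> F \<Longrightarrow> x + y \<in> F"
    and mult: "\<And>x y. x \<in> F \<Longrightarrow> y \<in> F \<Longrightarrow> x * y \<in> F"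
    and n: "2 * q\<^sup>2 \<le> n"
  obtains V1 V2 :: "nat set" and E where
    "bipartite_graph V1 V2 E" "card (V1 \<union> V2) = n" "C4_free E" "q ^ 3 \<le> card E"
proof -
  have "card (F \<times> F) = q\<^sup>2"
    using q by (simp add: card_cartesian_product power2_eq_square)
  then obtain k where k: "bij_betw k {..<q\<^sup>2} (F \<times> F)"
    using ex_bij_betw_nat_finite[of "F \<times> F"] fin by (auto simp: atLeast0LessThan)
  \<comment> \<open>\<open>k s\<close> gives the coordinates of the point \<open>s\<close> as well as slope and intercept of the line \<open>s\<close>.\<close>
  define D where "D = {(s, t). s < q\<^sup>2 \<and> t < q\<^sup>2 \<and> snd (k s) = fst (k t) * fst (k s) + snd (k t)}"
  \<comment> \<open>Points are numbered from 0 and lines from q^2, so an edge determines its pair in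
    \<open>D\<close>. The numbers from 2 q^2 up to n are the isolated vertices, placed in
    \<open>V1\<close>.\<close>
  define E where "E = (\<lambda>(s, t). {s, q\<^sup>2 + t}) ` D"
  define V1 where "V1 = {..<q\<^sup>2} \<union> {2 * q\<^sup>2..<n}"
  define V2 where "V2 = {q\<^sup>2..<2 * q\<^sup>2}"
  have "V1 \<union> V2 = {..<n}"
    using n by (auto simp: V1_def V2_def)
  moreover have "{s, q\<^sup>2 + t} \<subseteq> V1 \<union> V2 \<and> card {s, q\<^sup>2 + t} = 2 \<and> s \<in> V1 \<and> q\<^sup>2 + t \<in> V2"
    if "(s, t) \<in> D" for s t
    using that by (auto simp: D_def V1_def V2_def card_insert_if)
  ultimately have bip: "bipartite_graph V1 V2 E"
    unfolding bipartite_graph_def simple_graph_def E_def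
    by (fastforce simp: V1_def V2_def)
  have k_eq: "s = t" if "k s = k t" "s < q\<^sup>2" "t < q\<^sup>2" for s t
    using k that by (auto simp: bij_betw_def inj_on_def)
  have D_unique: "s = s' \<or> t = t'"
    if "(s, t) \<in> D" "(s, t') \<in> D" "(s', t) \<in> D" "(s', t') \<in> D" for s s' t t'
  proof -
    have "k s = k s' \<or> k t = k t'"
      using that affine_incidence_unique[of "snd (k s)" "fst (k t)" "fst (k s)" "snd (k t)"
          "fst (k t')" "snd (k t')" "snd (k s')" "fst (k s')"]
      by (auto simp: D_def prod_eq_iff)
    then show ?thesis
      using that k_eq by (auto simp: D_def)
  qed
  have E_cases: "u < q\<^sup>2 \<and> q\<^sup>2 \<le> v \<and> (u, v - q\<^sup>2) \<in> D \<or> v < q\<^sup>2 \<and> q\<^sup>2 \<le> u \<and> (v, u - q\<^sup>2) \<in> D"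
    if "{u, v} \<in> E" for u v
    using that by (auto simp: E_def D_def doubleton_eq_iff)
  have "C4_free E"
    unfolding C4_free_def
  proof (intro allI impI)
    fix u v x y
    assume "{u, x} \<in> E" "{u, y} \<in> E" "{v, x} \<in> E" "{v, y} \<in> E"
    note cyc = this[THEN E_cases]
    show "u = v \<or> x = y"
    \<comment> \<open>The side of \<open>u\<close> determines the sides of the other three vertices;
      the second case exchanges points and lines.\<close>
    proof (cases "u < q\<^sup>2")
      case True
      with cyc have "(u, x - q\<^sup>2) \<in> D" "(u, y - q\<^sup>2) \<in> D" "(v, x - q\<^sup>2) \<in> D" "(v, y - q\<^sup>2) \<in> D"
        "q\<^sup>2 \<le> x" "q\<^sup>2 \<le> y"
        by linarith+
      with D_unique show ?thesis
        by (metis le_add_diff_inverse)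
    next
      case False
      with cyc have "(x, u - q\<^sup>2) \<in> D" "(y, u - q\<^sup>2) \<in> D" "(x, v - q\<^sup>2) \<in> D" "(y, v - q\<^sup>2) \<in> D"
        "q\<^sup>2 \<le> u" "q\<^sup>2 \<le> v"
        by linarith+
      with D_unique show ?thesis
        by (metis le_add_diff_inverse)
    qed
  qed
  have finD: "finite D"
    by (rule finite_subset[of _ "{..<q\<^sup>2} \<times> {..<q\<^sup>2}"]) (auto simp: D_def)
  \<comment> \<open>Each of the q^2 lines has a point above every abscissa in \<open>F\<close>,
    which gives q^3 incidences.\<close>
  have "F \<times> {..<q\<^sup>2} \<subseteq> (\<lambda>(s, t). (fst (k s), t)) ` D"
  proof (rule subrelI)
    fix x t assume "(x, t) \<in> F \<times> {..<q\<^sup>2}"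
    then have x: "x \<in> F" and t: "t \<in> {..<q\<^sup>2}"
      by auto
    then have "k t \<in> F \<times> F"
      using k by (auto simp: bij_betw_def)
    then have "(x, fst (k t) * x + snd (k t)) \<in> k ` {..<q\<^sup>2}"
      using k x add mult by (auto simp: bij_betw_def mem_Times_iff)
    then obtain s where "s < q\<^sup>2" "k s = (x, fst (k t) * x + snd (k t))"
      by auto
    then show "(x, t) \<in> (\<lambda>(s, t). (fst (k s), t)) ` D"
      using t by (intro image_eqI[of _ _ "(s, t)"]) (auto simp: D_def)
  qed
  then have "card (F \<times> {..<q\<^sup>2}) \<le> card D"
    by (rule surj_card_le[OF finD])
  moreover have "card E = card D"
    unfolding E_def by (rule card_image) (auto simp: inj_on_def D_def doubleton_eq_iff)
  ultimately have "q ^ 3 \<le> card E"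
    using q by (simp add: card_cartesian_product power2_eq_square power3_eq_cube)
  moreover have "card (V1 \<union> V2) = n"
    using \<open>V1 \<union> V2 = {..<n}\<close> by simp
  ultimately show ?thesis
    using that bip \<open>C4_free E\<close> by blast
qed

section \<open>Finite fields of characteristic 2\<close>

text \<open>The polynomial splits into linear factors, and a repeated factor would give a common
  root with the derivative, so the multiset of roots has no repetition.\<close>

lemma alg_closed_separable_card_roots:
  fixes p :: "'a :: alg_closed_field poly"
  assumes sep: "\<And>x. poly p x = 0 \<Longrightarrow> poly (pderiv p) x \<noteq> 0"
  shows "card {x. poly p x = 0} = Polynomial.degree p"
proof -
  have "p \<noteq> 0"
    using sep[of 0] by auto
  then obtain A where A: "size A = Polynomial.degree p"
    and p: "p = smult (lead_coeff p) (\<Prod>x\<in>#A. [:-x, 1:])"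
    using alg_closed_imp_factorization by blast
  have roots: "{x. poly p x = 0} = set_mset A"
    using \<open>p \<noteq> 0\<close> by (subst p) (auto simp: poly_prod_mset)
  have "count A x = 1" if "x \<in># A" for x
  proof (rule ccontr)
    assume "count A x \<noteq> 1"
    with that obtain B where B: "A = add_mset x (add_mset x B)"
      by (metis count_add_mset count_eq_zero_iff insert_DiffM One_nat_def)
    define r where "r = smult (lead_coeff p) (\<Prod>x\<in>#B. [:-x, 1:])"
    have "p = [:-x, 1:] * ([:-x, 1:] * r)"
      by (subst p) (simp add: B r_def mult_smult_right)
    then have "poly p x = 0" "poly (pderiv p) x = 0"
      by (simp_all only: pderiv_mult poly_add poly_mult) simp_all
    with sep show False by blast
  qed
  then have "size A = card (set_mset A)"
    by (simp add: size_multiset_overloaded_eq)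
  with A roots show ?thesis
    by simp
qed

lemma CHAR_bit_alg_closure: "CHAR(bit alg_closure) = 2"
proof -
  have "CHAR(bit) dvd 2"
    by (simp flip: of_nat_eq_0_iff_char_dvd)
  then have "CHAR(bit) = 2"
    using two_is_prime_nat CHAR_not_1' by (metis One_nat_def prime_nat_iff)
  then show ?thesis
    by simp
qed

text \<open>The field consists of the fixed points of x -> x^q, that is, the roots of X^q - X. The
  derivative is the constant -1 in characteristic 2, so there are q distinct roots; sums stay inside
  because x -> x^q is additive.\<close>

lemma finite_field_two_power:
  fixes k :: nat
  assumes "k > 0"
  obtains F :: "bit alg_closure set" where "card F = 2 ^ k"
    "\<And>x y. x \<in> F \<Longrightarrow> y \<in> F \<Longrightarrow> x + y \<in> F" "\<And>x y. x \<in> F \<Longrightarrow> y \<in> F \<Longrightarrow> x * y \<in> F"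
proof -
  define q :: nat where "q = 2 ^ k"
  define F :: "bit alg_closure set" where "F = {x. x ^ q = x}"
  define p :: "bit alg_closure poly" where "p = monom 1 q + monom (-1) 1"
  have "q > 1"
    unfolding q_def by (rule one_less_power) (simp_all add: assms)
  have "(2 :: bit alg_closure) = 0"
    using of_nat_CHAR[where 'a = "bit alg_closure"]
    by (simp only: CHAR_bit_alg_closure of_nat_numeral)
  then have "of_nat q = (0 :: bit alg_closure)"
    using assms by (simp add: q_def)
  then have "pderiv p = [:-1:]"
    by (simp add: p_def pderiv_add pderiv_monom monom_0)
  then have "card {x. poly p x = 0} = Polynomial.degree p"
    by (intro alg_closed_separable_card_roots) simp
  moreover have "Polynomial.degree p = q"
    unfolding p_def using \<open>q > 1\<close> by (subst degree_add_eq_left) (simp_all add: degree_monom_eq)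
  moreover have "{x. poly p x = 0} = F"
    by (simp add: p_def F_def poly_monom)
  ultimately have "card F = 2 ^ k"
    by (simp add: q_def)
  moreover have "x + y \<in> F" if "x \<in> F" "y \<in> F" for x y
    using that freshmans_dream'[where m = q and n = k and x = x and y = y]
    by (simp add: F_def q_def CHAR_bit_alg_closure del: CHAR_alg_closure)
  moreover have "x * y \<in> F" if "x \<in> F" "y \<in> F" for x y
    using that by (simp add: F_def power_mult_distrib)
  ultimately show ?thesis
    using that by blast
qed

text \<open>For k = 1, 2, ... the intervals from 2 * 4^k to 8 * 4^k tile the numbers from 8 on, each
  ending where the next begins. Dividing n by 4 moves down one interval.\<close>

lemma power_four_scale:
  fixes n :: nat
  assumes "8 \<le> n"
  obtains k where "k > 0" "2 * (2 ^ k)\<^sup>2 \<le> n" "n < 8 * (2 ^ k)\<^sup>2"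
proof -
  have "\<exists>k>0. 2 * 4 ^ k \<le> n \<and> n < 8 * 4 ^ k"
    using assms
  proof (induction n rule: less_induct)
    case (less n)
    show ?case
    proof (cases "n < 32")
      case True
      with less.prems show ?thesis
        by (intro exI[of _ 1]) simp
    next
      case False
      then have "n div 4 < n" "8 \<le> n div 4"
        by simp_all
      then obtain k where "2 * 4 ^ k \<le> n div 4" "n div 4 < 8 * 4 ^ k"
        using less.IH by blast
      then show ?thesis
        by (intro exI[of _ "Suc k"]) auto
    qed
  qed
  moreover have "(2 ^ k)\<^sup>2 = (4 :: nat) ^ k" for k
    by (simp add: power2_eq_square flip: power_mult_distrib)
  ultimately show ?thesis
    using that by metis
qed

theorem theorem5p6:
  "\<exists>c::real. c > 0 \<and> (\<exists>N::nat. \<forall>n::nat. \<exists>(V1::nat set) (V2::nat set) (E::nat set set).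
     bipartite_graph V1 V2 E \<and> card (V1 \<union> V2) = n \<and>
     graph_vc_dim (V1 \<union> V2) E \<le> 2 \<and>
     (n \<ge> N \<longrightarrow>
       (\<forall>E'. spanner 3 (V1 \<union> V2) E E' \<longrightarrow> real (card E') \<ge> c * real n powr (3/2))))"
proof (intro exI[of _ "1/27"] conjI exI[of _ 8] allI)
  fix n :: nat
  show "\<exists>(V1::nat set) (V2::nat set) (E::nat set set).
     bipartite_graph V1 V2 E \<and> card (V1 \<union> V2) = n \<and>
     graph_vc_dim (V1 \<union> V2) E \<le> 2 \<and>
     (n \<ge> 8 \<longrightarrow>
       (\<forall>E'. spanner 3 (V1 \<union> V2) E E' \<longrightarrow> real (card E') \<ge> 1/27 * real n powr (3/2)))"
  proof (cases "n \<ge> 8")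
    case False
    \<comment> \<open>Below 8 only the vertex count and the VC bound are demanded, so an edgeless
      graph serves.\<close>
    have "C4_free ({} :: nat set set)"
      by (simp add: C4_free_def)
    with False show ?thesis
      by (intro exI[of _ "{..<n}"] exI[of _ "{}"])
        (auto simp: bipartite_graph_def simple_graph_def intro: C4_free_graph_vc_dim_le)
  next
    case True
    then obtain k where k: "k > 0" "2 * (2 ^ k)\<^sup>2 \<le> n" "n < 8 * (2 ^ k)\<^sup>2"
      by (rule power_four_scale)
    define q :: nat where "q = 2 ^ k"
    obtain F :: "bit alg_closure set" where F: "card F = q"
      "\<And>x y. x \<in> F \<Longrightarrow> y \<in> F \<Longrightarrow> x + y \<in> F" "\<And>x y. x \<in> F \<Longrightarrow> y \<in> F \<Longrightarrow> x * y \<in> F"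
      using finite_field_two_power[OF k(1)] unfolding q_def by metis
    \<comment> \<open>An infinite set has \<open>card\<close> 0, so positive cardinality forces
      finiteness.\<close>
    moreover have "finite F"
      using F(1) by (intro card_ge_0_finite) (simp add: q_def)
    moreover have "2 * q\<^sup>2 \<le> n"
      using k by (simp add: q_def)
    ultimately obtain V1 V2 :: "nat set" and E where G: "bipartite_graph V1 V2 E"
      "card (V1 \<union> V2) = n" "C4_free E" "q ^ 3 \<le> card E"
      by (metis affine_plane_incidence_graph)
    \<comment> \<open>Relaxing the factor 8 to the square 9 turns n^(3/2) into at most (3 q)^3 = 27
      q^3, whence the constant 1/27.\<close>
    have "n \<le> 9 * q\<^sup>2"
      using k by (simp add: q_def)
    then have "real n \<le> real (9 * q\<^sup>2)"
      by (simp only: of_nat_le_iff)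
    then have "real n powr (3/2) \<le> ((3 * real q)\<^sup>2) powr (3/2)"
      by (intro powr_mono2) (simp_all add: power_mult_distrib)
    also have "\<dots> = ((3 * real q) powr 2) powr (3/2)"
      by (simp add: q_def)
    also have "\<dots> = (3 * real q) powr 3"
      unfolding powr_powr by simp
    also have "\<dots> = 27 * real (q ^ 3)"
      by (simp add: q_def power_mult_distrib)
    also have "\<dots> \<le> 27 * real (card E)"
      using G(4) by (simp only: mult_le_cancel_left_pos of_nat_le_iff)
    finally have "1/27 * real n powr (3/2) \<le> real (card E)"
      by simp
    with G C4_free_3_spanner_eq[OF G(1,3)] show ?thesis
      by (intro exI[of _ V1] exI[of _ V2] exI[of _ E]) (auto intro: C4_free_graph_vc_dim_le)
  qed
qed simp

end
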